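(* Any polynomial ensemble is a Giambelli compatible point process. That is, let $(x_1,\ldots,x_N)$ be distributed according to a polynomial ensemble on $I^N$, where $I\subseteq\mathbb{R}$ is an interval, i.e. with probability density $$\mathcal{P}(x_1,\ldots,x_N)=\frac{1}{\mathcal{Z}_N}\,\Delta_N(x_1,\ldots,x_N)\,\det[\varphi_l(x_k)]_{k,l=1}^N .$$ Then for every Young diagram $\lambda=(p_1,\ldots,p_d\,|\,q_1,\ldots,q_d)$ written in Frobenius notation, $$\mathbb{E}\left[s_{(p_1,\ldots,p_d|q_1,\ldots,q_d)}(x_1,\ldots,x_N)\right]=\det\left[\mathbb{E}\left[s_{(p_i|q_j)}(x_1,\ldots,x_N)\right]\right]_{i,j=1}^d ,$$ where $\mathbb{E}$ denotes expectation with respect to $\mathcal{P}$.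
   Context: Polynomial ensemble: $I\subseteq\mathbb{R}$ is an interval, $\varphi_1,\ldots,\varphi_N$ are certain integrable real-valued functions on $I$, $\Delta_N(x_1,\ldots,x_N)=\prod_{1\le i<j\le N}(x_i-x_j)=\det[x_i^{N-j}]_{i,j=1}^N$ is the Vandermonde determinant, and the normalisation constant $\mathcal{Z}_N=\int_{I^N}\Delta_N(x_1,\ldots,x_N)\det[\varphi_l(x_k)]_{k,l=1}^N\,dx_1\cdots dx_N$ exists and is non-zero. One has $\mathcal{Z}_N=N!\,(-1)^{N(N-1)/2}\det G$ with the (invertible) generalised moment matrix $G=(g_{k,l})_{k,l=1}^N$, $g_{k,l}=\int_I x^{k-1}\varphi_l(x)\,dx$. The function $\mathcal{P}$ is a probability density on $I^N$. Giambelli compatible point process: a point process formed by an $N$-point configuration $(x_1,\ldots,x_N)$ on $I\subseteq\mathbb{R}$ for which the Giambelli formula $s_{(p_1,\ldots,p_d|q_1,\ldots,q_d)}(x_1,\ldots,x_N)=\det[s_{(p_i|q_j)}(x_1,\ldots,x_N)]_{i,j=1}^d$, valid for Schur polynomials parameterised by an arbitrary Young diagram, extends to averages, i.e. the displayed identity of the claim holds. Frobenius notation: $\lambda=(p_1,\ldots,p_d|q_1,\ldots,q_d)$ means that $\lambda$ has $d$ boxes on its diagonal, $p_j$ is the number of boxes in the $j$-th row of $\lambda$ to the right of the diagonal, and $q_j$ is the number of boxes in the $j$-th column of $\lambda$ below the diagonal. In particular $(p|q)$ is the hook diagram with first row of length $p+1$ and first column of length $q+1$. Schur polynomials: for a Young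 diagram $\lambda$ with $l(\lambda)\le N$ rows $\lambda_1\ge\cdots\ge\lambda_{l(\lambda)}>0$ (and $\lambda_j=0$ for $j>l(\lambda)$), $s_\lambda(x_1,\ldots,x_N)=\det[x_i^{\lambda_j+N-j}]_{i,j=1}^N/\Delta_N(x_1,\ldots,x_N)$; if $l(\lambda)>N$, then $s_\lambda(x_1,\ldots,x_N)\equiv 0$. *)

theory Defs
  imports "HOL-Probability.Probability" "Jordan_Normal_Form.Determinant"
begin

(* All indices start at 0: a configuration of N points is a function on {..<N}, and the
   i-th row, column or function of the usual 1-based notation has index i - 1.
   The constants det and mat exist both in HOL-Analysis and in Jordan_Normal_Form. The
   qualified names below select the latter, where the size of a matrix is a natural number. *)

(* The list of the positive row lengths; its length is the number of rows. *)
definition young_diagram :: "nat list \<Rightarrow> bool" where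
  "young_diagram lam \<longleftrightarrow> sorted_wrt (\<ge>) lam \<and> (\<forall>r\<in>set lam. 0 < r)"

definition row_length :: "nat list \<Rightarrow> nat \<Rightarrow> nat" where
  "row_length lam i = (if i < length lam then lam ! i else 0)"

definition boxes :: "nat list \<Rightarrow> (nat \<times> nat) set" where
  "boxes lam = {(i, j). i < length lam \<and> j < lam ! i}"

(* Frobenius notation (p_1,...,p_d | q_1,...,q_d): frob_rank is d, frob_arm gives the p_j and
   frob_leg gives the q_j. *)
definition frob_rank :: "nat list \<Rightarrow> nat" where
  "frob_rank lam = card {i. (i, i) \<in> boxes lam}"

definition frob_arm :: "nat list \<Rightarrow> nat \<Rightarrow> nat" where
  "frob_arm lam i = card {j. i < j \<and> (i, j) \<in> boxes lam}"

definition frob_leg :: "nat list \<Rightarrow> nat \<Rightarrow> nat" where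
  "frob_leg lam j = card {i. j < i \<and> (i, j) \<in> boxes lam}"

definition hook :: "nat \<Rightarrow> nat \<Rightarrow> nat list" where
  "hook p q = (p + 1) # replicate q 1"

definition vandermonde :: "nat \<Rightarrow> (nat \<Rightarrow> real) \<Rightarrow> real" where
  "vandermonde N x = (\<Prod>j<N. \<Prod>i<j. (x i - x j))"

(* With 0-based j the exponent lambda_j + N - j becomes row_length lam j + (N - Suc j).
   Where two points coincide the quotient has the value 0 (x / 0 = 0) instead of the value of the
   polynomial; these configurations form a Lebesgue null set. *)
definition schur :: "nat \<Rightarrow> nat list \<Rightarrow> (nat \<Rightarrow> real) \<Rightarrow> real" where
  "schur N lam x =
    (if length lam \<le> N
     then Determinant.det (Matrix.mat N N (\<lambda>(i, j). x i ^ (row_length lam j + (N - Suc j))))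
            / vandermonde N x
     else 0)"

abbreviation lborel_pow :: "nat \<Rightarrow> (nat \<Rightarrow> real) measure" where
  "lborel_pow N \<equiv> Pi\<^sub>M {..<N} (\<lambda>_. lborel)"

abbreviation set_pow :: "real set \<Rightarrow> nat \<Rightarrow> (nat \<Rightarrow> real) set" where
  "set_pow I N \<equiv> Pi\<^sub>E {..<N} (\<lambda>_. I)"

definition pe_weight :: "nat \<Rightarrow> (nat \<Rightarrow> real \<Rightarrow> real) \<Rightarrow> (nat \<Rightarrow> real) \<Rightarrow> real" where
  "pe_weight N \<phi> x =
    vandermonde N x * Determinant.det (Matrix.mat N N (\<lambda>(k, l). \<phi> l (x k)))"

definition pe_norm :: "nat \<Rightarrow> real set \<Rightarrow> (nat \<Rightarrow> real \<Rightarrow> real) \<Rightarrow> real" where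
  "pe_norm N I \<phi> = (LINT x:set_pow I N|lborel_pow N. pe_weight N \<phi> x)"

definition pe_density :: "nat \<Rightarrow> real set \<Rightarrow> (nat \<Rightarrow> real \<Rightarrow> real) \<Rightarrow> (nat \<Rightarrow> real) \<Rightarrow> real" where
  "pe_density N I \<phi> x = pe_weight N \<phi> x / pe_norm N I \<phi>"

(* The second integrability condition is the existence of the normalisation constant. The total
   mass of the density is 1 by construction, so it is a probability density as soon as it is
   nonnegative almost everywhere. *)
definition polynomial_ensemble :: "nat \<Rightarrow> real set \<Rightarrow> (nat \<Rightarrow> real \<Rightarrow> real) \<Rightarrow> bool" where
  "polynomial_ensemble N I \<phi> \<longleftrightarrow>
     is_interval I \<and>
     (\<forall>l<N. set_integrable lborel I (\<phi> l)) \<and>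
     set_integrable (lborel_pow N) (set_pow I N) (pe_weight N \<phi>) \<and>
     pe_norm N I \<phi> \<noteq> 0 \<and>
     (AE x in lborel_pow N. x \<in> set_pow I N \<longrightarrow> 0 \<le> pe_density N I \<phi> x)"

definition pe_measure :: "nat \<Rightarrow> real set \<Rightarrow> (nat \<Rightarrow> real \<Rightarrow> real) \<Rightarrow> (nat \<Rightarrow> real) measure" where
  "pe_measure N I \<phi> =
     density (lborel_pow N)
       (\<lambda>x. ennreal (indicator (set_pow I N) x * pe_density N I \<phi> x))"

(* M is the distribution of the N-point configuration on I. The identity is a statement about
   expectations, so it is required for every diagram for which the expectations in it exist; the
   two integrability premises are needed because the Bochner integral of a non-integrable function
   is 0 by convention. *)
definition giambelli_compatible :: "nat \<Rightarrow> real set \<Rightarrow> (nat \<Rightarrow> real) measure \<Rightarrow> bool" where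
  "giambelli_compatible N I M \<longleftrightarrow>
     prob_space M \<and> sets M = sets (lborel_pow N) \<and> (AE x in M. x \<in> set_pow I N) \<and>
     (\<forall>lam. young_diagram lam \<longrightarrow>
        integrable M (schur N lam) \<longrightarrow>
        (\<forall>i<frob_rank lam. \<forall>j<frob_rank lam.
           integrable M (schur N (hook (frob_arm lam i) (frob_leg lam j)))) \<longrightarrow>
        (LINT x|M. schur N lam x) =
          Determinant.det (Matrix.mat (frob_rank lam) (frob_rank lam)
            (\<lambda>(i, j). LINT x|M. schur N (hook (frob_arm lam i) (frob_leg lam j)) x)))"

end

(* By Andreief's identity, E[s_lam] is det[m_(lam_j + N - 1 - j)] / det[m_(N - 1 - j)], where m_k is
   the row vector with entries int x^k phi_l(x) dx. In the basis m_(N-1), ..., m_0 the rows with j below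
   the Frobenius rank are the coefficient vectors of m_(N + p_j), and the other rows are unit
   vectors, namely those whose index is not among the q_j. So E[s_lam] is, up to sign, the minor of
   the coefficient matrix with entries (m_(N + p_i))_(q_j), and for a hook it is a single entry.

   The assumptions only give integrability on I^N of det[x_i^e_j] det[phi_l(x_i)]. That the single
   moments exist follows by varying one coordinate: for almost every choice of the others, the first
   factor is a polynomial of exact degree e_0 in that coordinate, and by Cramer's rule each phi_l is
   a combination of the N functions which the second factor yields. *)

theory Submission
  imports Defs
begin

section \<open>Determinants of functions of two indices\<close>

text \<open>With entries given by a function, rows can be replaced, shifted or composed with index
  maps without carrier conditions.\<close>

definition fdet :: "nat \<Rightarrow> (nat \<Rightarrow> nat \<Rightarrow> 'a::comm_ring_1) \<Rightarrow> 'a" where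
  "fdet n a = Determinant.det (Matrix.mat n n (\<lambda>(i, j). a i j))"

lemma fdet_cong:
  assumes "\<And>i j. i < n \<Longrightarrow> j < n \<Longrightarrow> a i j = b i j"
  shows "fdet n a = fdet n b"
  unfolding fdet_def by (rule arg_cong[where f = Determinant.det]) (auto simp: assms)

lemma fdet_0 [simp]: "fdet 0 a = 1"
  by (simp add: fdet_def)

lemma fdet_leibniz:
  "fdet n a = (\<Sum>p | p permutes {..<n}. of_int (sign p) * (\<Prod>i<n. a i (p i)))"
proof -
  have "fdet n a = (\<Sum>p | p permutes {0..<n}. of_int (sign p) *
      (\<Prod>i = 0..<n. Matrix.mat n n (\<lambda>(i, j). a i j) $$ (i, p i)))"
    unfolding fdet_def by (rule det_def') simp
  also have "\<dots> = (\<Sum>p | p permutes {0..<n}. of_int (sign p) * (\<Prod>i = 0..<n. a i (p i)))"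
    by (intro sum.cong refl arg_cong2[where f = "(*)"] prod.cong)
       (auto dest: permutes_in_image)
  finally show ?thesis
    by (simp add: atLeast0LessThan)
qed

lemma fdet_permute_rows:
  assumes "p permutes {..<n}"
  shows "fdet n (\<lambda>i. a (p i)) = of_int (sign p) * fdet n a"
proof -
  have "fdet n (\<lambda>i. a (p i)) =
      Determinant.det (Matrix.mat n n (\<lambda>(i, j). Matrix.mat n n (\<lambda>(i, j). a i j) $$ (p i, j)))"
    unfolding fdet_def using permutes_in_image[OF assms]
    by (intro arg_cong[where f = Determinant.det] cong_mat) simp_all
  also have "\<dots> = of_int (sign p) * fdet n a"
    unfolding fdet_def using assms
    by (intro det_permute_rows) (simp_all add: atLeast0LessThan)
  finally show ?thesis .
qed

lemma fdet_mult:
  "fdet n (\<lambda>i j. \<Sum>k<n. a i k * b k j) = fdet n a * fdet n b"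
  unfolding fdet_def
  by (subst det_mult[symmetric, where n = n])
     (auto intro!: arg_cong[where f = Determinant.det] eq_matI
        simp: scalar_prod_def atLeast0LessThan)

lemma fdet_expand_row:
  assumes "i \<le> n"
  shows "fdet (Suc n) a =
    (\<Sum>j\<le>n. a i j * ((-1) ^ (i + j) * fdet n (\<lambda>r c. a (insert_index i r) (insert_index j c))))"
proof -
  have *: "mat_delete (Matrix.mat (Suc n) (Suc n) (\<lambda>(i, j). a i j)) i j =
      Matrix.mat n n (\<lambda>(r, c). a (insert_index i r) (insert_index j c))" for j
    by (rule eq_matI) (auto simp: mat_delete_def insert_index_def)
  show ?thesis
    unfolding fdet_def using assms
    by (subst laplace_expansion_row[of _ "Suc n" i])
       (auto simp: cofactor_def * lessThan_Suc_atMost[symmetric] intro!: sum.cong)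
qed

lemma fdet_transpose: "fdet n (\<lambda>i j. a j i) = fdet n a"
proof -
  have *: "Matrix.mat n n (\<lambda>(i, j). a j i) = transpose_mat (Matrix.mat n n (\<lambda>(i, j). a i j))"
    by (rule eq_matI) auto
  show ?thesis
    unfolding fdet_def * by (rule det_transpose) auto
qed

lemma fdet_expand_col:
  assumes "j \<le> n"
  shows "fdet (Suc n) a =
    (\<Sum>i\<le>n. a i j * ((-1) ^ (i + j) * fdet n (\<lambda>r c. a (insert_index i r) (insert_index j c))))"
  using fdet_expand_row[OF assms, of "\<lambda>i j. a j i"]
  by (simp add: fdet_transpose[of _ a] add.commute
      fdet_transpose[where a = "\<lambda>r c. a (insert_index i r) (insert_index j c)" for i])

lemma fdet_scale_rows: "fdet n (\<lambda>i j. c i * a i j) = (\<Prod>i<n. c i) * fdet n a"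
  by (simp add: fdet_leibniz prod.distrib sum_distrib_left mult.left_commute)

lemma fdet_block_upper:
  fixes a :: "nat \<Rightarrow> nat \<Rightarrow> 'a::idom"
  assumes "\<And>i j. i < m \<Longrightarrow> j < d \<Longrightarrow> a (d + i) j = 0"
  shows "fdet (d + m) a = fdet d a * fdet m (\<lambda>i j. a (d + i) (d + j))"
proof -
  have *: "Matrix.mat (d + m) (d + m) (\<lambda>(i, j). a i j) =
      four_block_mat (Matrix.mat d d (\<lambda>(i, j). a i j)) (Matrix.mat d m (\<lambda>(i, j). a i (d + j)))
        (0\<^sub>m m d) (Matrix.mat m m (\<lambda>(i, j). a (d + i) (d + j)))"
    by (rule eq_matI) (auto simp: not_less assms dest!: le_Suc_ex)
  show ?thesis
    unfolding fdet_def * by (rule det_four_block_mat_lower_left_zero) auto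
qed

lemma fdet_identity [simp]: "fdet n (\<lambda>i j. if i = j then 1 else 0) = 1"
proof -
  have *: "Matrix.mat n n (\<lambda>(i, j). if i = j then 1 else 0) = (1\<^sub>m n :: 'a mat)"
    by (rule eq_matI) auto
  show ?thesis unfolding fdet_def * by simp
qed

text \<open>The cofactors along row \<open>i\<close> do not involve row \<open>i\<close>, so those
  of \<open>a\<close> serve for every \<open>w\<close>. This makes the determinant visibly linear in
  \<open>w\<close>.\<close>

lemma fdet_replace_row:
  assumes "i < n"
  shows "fdet n (\<lambda>r. if r = i then w else a r) =
    (\<Sum>j<n. w j * cofactor (Matrix.mat n n (\<lambda>(i, j). a i j)) i j)"
proof -
  let ?A = "Matrix.mat n n (\<lambda>(i, j). a i j)"
  let ?B = "Matrix.mat n n (\<lambda>(r, j). (if r = i then w else a r) j)"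
  have "mat_delete ?B i j = mat_delete ?A i j" for j
    by (rule eq_matI) (auto simp: mat_delete_def)
  then show ?thesis
    unfolding fdet_def using assms
    by (subst laplace_expansion_row[of _ n i]) (auto simp: cofactor_def intro!: sum.cong)
qed

text \<open>Cramer's rule for writing a row vector as a combination of the rows of \<open>a\<close>.\<close>
lemma fdet_cramer_row:
  assumes "l < n"
  shows "(\<Sum>i<n. fdet n (\<lambda>r. if r = i then w else a r) * a i l) = fdet n a * w l"
proof -
  let ?A = "Matrix.mat n n (\<lambda>(i, j). a i j)"
  have A: "?A \<in> carrier_mat n n" by simp
  have adj: "(\<Sum>i<n. cofactor ?A i j * a i l) = (if j = l then fdet n a else 0)" if "j < n" for j
  proof -
    have "(\<Sum>i<n. cofactor ?A i j * a i l) = (adj_mat ?A * ?A) $$ (j, l)"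
      using that assms adj_mat(1)[OF A]
      by (auto simp: scalar_prod_def atLeast0LessThan adj_mat_def intro!: sum.cong)
    also have "\<dots> = (if j = l then fdet n a else 0)"
      unfolding adj_mat(3)[OF A] using that assms by (auto simp: fdet_def)
    finally show ?thesis .
  qed
  have "(\<Sum>i<n. fdet n (\<lambda>r. if r = i then w else a r) * a i l) =
      (\<Sum>i<n. \<Sum>j<n. w j * (cofactor ?A i j * a i l))"
    by (intro sum.cong refl) (simp add: fdet_replace_row sum_distrib_right mult.assoc)
  also have "\<dots> = (\<Sum>j<n. w j * (\<Sum>i<n. cofactor ?A i j * a i l))"
    by (subst sum.swap) (simp add: sum_distrib_left)
  also have "\<dots> = (\<Sum>j<n. if j = l then w j * fdet n a else 0)"
    by (intro sum.cong refl) (simp add: adj)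
  also have "\<dots> = fdet n a * w l"
    using assms by (simp add: mult.commute)
  finally show ?thesis .
qed

text \<open>By column operations: subtracting \<open>x n\<close> times the next column from each
  column leaves only the last entry in row \<open>n\<close>, and every other row \<open>i\<close>
  releases a factor \<open>x i - x n\<close>.\<close>

lemma fdet_vandermonde:
  "fdet n (\<lambda>i j. x i ^ (n - Suc j)) = vandermonde n x"
proof (induction n)
  case 0
  show ?case by (simp add: vandermonde_def)
next
  case (Suc n)
  let ?a = "\<lambda>i j. x i ^ (Suc n - Suc j)"
  \<comment> \<open>Right multiplication by this lower triangular matrix with unit diagonal carries
    out the column operations.\<close>
  let ?u = "\<lambda>k j. if k = j then 1 else if k = Suc j then - x n else 0"
  define b where "b i j = (\<Sum>k<Suc n. ?a i k * ?u k j)" for i j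
  have u: "fdet (Suc n) ?u = 1"
  proof -
    let ?U = "Matrix.mat (Suc n) (Suc n) (\<lambda>(i, j). ?u i j)"
    have "fdet (Suc n) ?u = prod_list (diag_mat ?U)"
      unfolding fdet_def by (rule det_lower_triangular[where n = "Suc n"]) auto
    also have "diag_mat ?U = map (\<lambda>_. 1) [0..<Suc n]"
      by (auto simp: diag_mat_def simp del: upt_Suc)
    also have "prod_list \<dots> = 1"
      by (simp add: map_replicate_const prod_list_replicate del: upt_Suc)
    finally show ?thesis .
  qed
  have b_less: "b i j = (x i - x n) * x i ^ (n - Suc j)" if "j < n" for i j
  proof -
    have "b i j = (\<Sum>k<Suc n. (if k = j then ?a i j else 0) +
        (if k = Suc j then - x n * ?a i (Suc j) else 0))"
      unfolding b_def by (intro sum.cong) auto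
    also have "\<dots> = ?a i j - x n * ?a i (Suc j)"
      using that by (subst sum.distrib) (simp add: sum.delta)
    finally show ?thesis
      using that by (simp add: Suc_diff_Suc algebra_simps flip: power_Suc)
  qed
  have b_last: "b i n = 1" for i
    unfolding b_def by (subst sum.mono_neutral_right[of _ "{n}"]) auto
  have "fdet (Suc n) ?a = fdet (Suc n) b"
    unfolding b_def fdet_mult u by simp
  also have "\<dots> = (\<Sum>j\<le>n. if j = n then fdet n (\<lambda>r c. b (insert_index n r) (insert_index j c)) else 0)"
    by (subst fdet_expand_row[OF le_refl], intro sum.cong refl) (auto simp: b_less b_last)
  also have "\<dots> = fdet n (\<lambda>r c. (x r - x n) * x r ^ (n - Suc c))"
    by (auto intro!: fdet_cong simp: b_less)
  also have "\<dots> = (\<Prod>i<n. x i - x n) * vandermonde n x"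
    unfolding fdet_scale_rows Suc.IH ..
  also have "\<dots> = vandermonde (Suc n) x"
    by (simp add: vandermonde_def mult.commute)
  finally show ?case .
qed


section \<open>Minors in Frobenius notation\<close>

text \<open>Row lengths are functions on all indices, zero from some row on, so that deleting the
  first row and column of the diagram is just \<open>\<lambda>j. f (Suc j) - 1\<close>.\<close>

definition leg :: "(nat \<Rightarrow> nat) \<Rightarrow> nat \<Rightarrow> nat" where
  "leg f c = card {i. c < i \<and> c < f i}"

text \<open>For \<open>c < f c\<close> this is the leg length \<open>q\<^sub>c\<close>; for the other \<open>c\<close> the values run through the
  remaining indices in increasing order.\<close>
definition frob_perm :: "(nat \<Rightarrow> nat) \<Rightarrow> nat \<Rightarrow> nat" where
  "frob_perm f c = (if c < f c then leg f c else c - f c)"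

text \<open>As \<open>f\<close> is antitone, the rows below \<open>c\<close> that reach column
  \<open>c\<close> are consecutive and start at \<open>Suc c\<close>, so their number determines
  them. The bound \<open>n\<close> makes their set finite.\<close>

lemma leg_less_iff:
  assumes "antimono f" "\<forall>i\<ge>n. f i = 0"
  shows "i \<le> c + leg f c \<longleftrightarrow> i \<le> c \<or> c < f i"
proof -
  let ?L = "{i. c < i \<and> c < f i}"
  have fin: "finite ?L"
    by (rule finite_subset[of _ "{..<n}"]) (use assms(2) in \<open>force simp: not_less[symmetric]\<close>)+
  show ?thesis
  proof (cases "c < f i")
    case True
    then have "{c<..i} \<subseteq> ?L"
      using antimonoD[OF assms(1)] by fastforce
    then have "card {c<..i} \<le> leg f c"
      unfolding leg_def by (rule card_mono[OF fin])
    with True show ?thesis by simp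
  next
    case False
    have "k < i" if "c < f k" for k
    proof (rule ccontr)
      assume "\<not> k < i"
      then have "f k \<le> f i"
        by (intro antimonoD[OF assms(1)]) simp
      with that False show False by linarith
    qed
    then have "?L \<subseteq> {c<..<i}" by auto
    then have "leg f c \<le> card {c<..<i}"
      unfolding leg_def by (rule card_mono[rotated]) simp
    with False show ?thesis by auto
  qed
qed

lemma leg_less:
  assumes "antimono f" "\<forall>i\<ge>n. f i = 0" "c < n"
  shows "leg f c < n"
proof -
  have "f n = 0" using assms(2) by simp
  then show ?thesis
    using leg_less_iff[OF assms(1,2), of n c] assms(3) by simp
qed

text \<open>The deletion moves the diagonal by one step and keeps what lies below it in each column.
  The truncated subtraction is harmless, since an empty row reaches no column.\<close>

lemma leg_Suc: "leg (\<lambda>j. f (Suc j) - 1) c = leg f (Suc c)"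
proof -
  have "i \<in> Suc ` {i. c < i \<and> c < f (Suc i) - 1} \<longleftrightarrow> Suc c < i \<and> Suc c < f i" for i
    by (cases i) (simp_all add: inj_image_mem_iff less_diff_conv)
  then have "{i. Suc c < i \<and> Suc c < f i} = Suc ` {i. c < i \<and> c < f (Suc i) - 1}"
    by blast
  then show ?thesis
    unfolding leg_def by (simp add: card_image)
qed

text \<open>Deleting the first row and the first column of the diagram amounts to expanding the
  determinant along its first column.\<close>
lemma fdet_frob_perm:
  assumes "antimono f" "\<forall>i\<ge>n. f i = 0"
  shows "fdet n (\<lambda>r c. if r = frob_perm f c then if c < f c then (-1) ^ leg f c else 1 else 0) =
    (1 :: 'a::comm_ring_1)"
  using assms
proof (induction n arbitrary: f)
  case 0
  show ?case by simp
next
  case (Suc n)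
  let ?C = "\<lambda>f r c. if r = frob_perm f c then if c < f c then (-1) ^ leg f c else 1 else 0 :: 'a"
  show ?case
  proof (cases "f 0 = 0")
    case True
    then have "f i = 0" for i
      using antimonoD[OF Suc.prems(1), of 0 i] by simp
    then have "fdet (Suc n) (?C f) = fdet (Suc n) (\<lambda>r c. if r = c then 1 else 0)"
      by (intro fdet_cong) (simp add: frob_perm_def)
    then show ?thesis by simp
  next
    case False
    define q where "q = leg f 0"
    define g where "g j = f (Suc j) - 1" for j
    have q_iff: "i \<le> q \<longleftrightarrow> i = 0 \<or> 0 < f i" for i
      unfolding q_def using leg_less_iff[OF Suc.prems, where i = i and c = 0] by simp
    have q: "q \<le> n"
      using leg_less[OF Suc.prems, where c = 0] by (simp add: q_def)
    have "antimono g"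
      unfolding g_def using antimonoD[OF Suc.prems(1)] by (auto intro!: antimonoI diff_le_mono)
    moreover have "g i = 0" if "n \<le> i" for i
      using that Suc.prems(2) by (simp add: g_def)
    ultimately have IH: "fdet n (?C g) = 1"
      by (intro Suc.IH) auto
    have leg_g: "leg g c = leg f (Suc c)" for c
      unfolding g_def by (rule leg_Suc)
    have less_g: "c < g c \<longleftrightarrow> Suc c < f (Suc c)" for c
      by (auto simp: g_def)
    \<comment> \<open>Deleting row \<open>q\<close> lowers the indices above \<open>q\<close> by
      one. Three cases: the leg of a later diagonal box is shorter than \<open>q\<close>; an empty
      row gives an index above \<open>q\<close>; a nonempty row without diagonal box gives an index
      below \<open>q\<close>.\<close>
    have eq: "insert_index q r = frob_perm f (Suc c) \<longleftrightarrow> r = frob_perm g c" for r c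
    proof -
      consider "Suc c < f (Suc c)" | "f (Suc c) = 0" | "0 < f (Suc c)" "f (Suc c) \<le> Suc c"
        by linarith
      then show ?thesis
      proof cases
        case 1
        then have "0 < f (Suc c + leg f (Suc c))"
          using leg_less_iff[OF Suc.prems, where i = "Suc c + leg f (Suc c)" and c = "Suc c"]
          by (cases "leg f (Suc c) = 0") auto
        then have "leg f (Suc c) < q"
          using q_iff[of "Suc c + leg f (Suc c)"] by linarith
        moreover have "frob_perm f (Suc c) = leg f (Suc c)" "frob_perm g c = leg f (Suc c)"
          using 1 by (simp_all add: frob_perm_def leg_g less_g)
        ultimately show ?thesis by (auto simp: insert_index_def)
      next
        case 2
        then have "q \<le> c"
          using q_iff[of "Suc c"] by linarith
        moreover have "frob_perm f (Suc c) = Suc c" "frob_perm g c = c"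
          using 2 by (simp_all add: frob_perm_def g_def)
        ultimately show ?thesis by (auto simp: insert_index_def)
      next
        case 3
        then have "c - (f (Suc c) - 1) < q"
          using q_iff[of "Suc c"] by linarith
        moreover have "frob_perm f (Suc c) = c - (f (Suc c) - 1)"
          "frob_perm g c = c - (f (Suc c) - 1)"
          using 3 by (auto simp: frob_perm_def g_def)
        ultimately show ?thesis by (auto simp: insert_index_def)
      qed
    qed
    have minor: "(\<lambda>r c. ?C f (insert_index q r) (insert_index 0 c)) = ?C g"
      by (intro ext) (auto simp: eq leg_g less_g)
    \<comment> \<open>The only nonzero entry of the first column is in row \<open>q\<close>, and its
      sign cancels the Laplace sign \<open>(-1) ^ (q + 0)\<close>. This is why the permutation
      matrix carries signs.\<close>
    have col: "?C f i 0 = (if i = q then (-1) ^ q else 0)" for i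
      using False by (simp add: frob_perm_def q_def)
    have "fdet (Suc n) (?C f) =
        (\<Sum>i\<le>n. ?C f i 0 * ((-1) ^ (i + 0) *
          fdet n (\<lambda>r c. ?C f (insert_index i r) (insert_index 0 c))))"
      by (rule fdet_expand_col) simp
    also have "\<dots> = (\<Sum>i\<le>n. if i = q then fdet n (?C g) else 0)"
      unfolding col
      apply (intro sum.cong refl)
      subgoal for i
        by (cases "i = q")
           (simp_all only: minor if_True if_False simp_thms add_0_right left_minus_one_mult_self
             mult_zero_left)
      done
    also have "\<dots> = 1"
      using q IH by simp
    finally show ?thesis .
  qed
qed

text \<open>Multiplication by the signed permutation matrix of \<open>fdet_frob_perm\<close>, whose
  determinant is 1, brings the columns \<open>leg f j\<close> to the front. The result is block
  upper triangular with an identity block at the lower right.\<close>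

lemma fdet_frobenius:
  fixes V :: "nat \<Rightarrow> nat \<Rightarrow> 'a::idom"
  assumes f: "antimono f" "\<forall>i\<ge>n. f i = 0"
    and d: "\<And>i. i < d \<longleftrightarrow> i < f i"
  shows "fdet n (\<lambda>i j. if i < d then V i j else if j = i - f i then 1 else 0) =
    fdet d (\<lambda>i j. (-1) ^ leg f j * V i (leg f j))"
proof -
  let ?B = "\<lambda>i j. if i < d then V i j else if j = i - f i then 1 else 0"
  let ?s = "\<lambda>c. if c < f c then (-1) ^ leg f c else 1 :: 'a"
  let ?C = "\<lambda>r c. if r = frob_perm f c then ?s c else 0 :: 'a"
  let ?D = "\<lambda>i j. \<Sum>k<n. ?B i k * ?C k j"
  have "d \<le> n"
    using d[of n] f(2) by simp
  then obtain m where m: "n = d + m"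
    using le_Suc_ex by blast
  have "frob_perm f c < n" if "c < n" for c
    using leg_less[OF f that] that by (auto simp: frob_perm_def)
  then have D: "?D i j = ?B i (frob_perm f j) * ?s j" if "j < n" for i j
    using that by (subst sum.mono_neutral_right[of _ "{frob_perm f j}"]) auto
  \<comment> \<open>No leg length is of the form \<open>i - f i\<close> with
    \<open>d \<le> i\<close>, so the lower left block vanishes.\<close>
  have lower_left: "leg f j \<noteq> i - f i" if "j < d" "d \<le> i" for i j
    using leg_less_iff[OF f, where i = i and c = j] that d[of i] d[of j] by linarith
  \<comment> \<open>From index \<open>d\<close> on, \<open>f i \<le> i\<close>, so the subtraction
    is not truncated and \<open>i - f i\<close> is strictly increasing.\<close>
  have inj: "j - f j = i - f i \<longleftrightarrow> i = j" if "d \<le> j" "d \<le> i" for i j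
    using that d[of i] d[of j] antimonoD[OF f(1), of i j] antimonoD[OF f(1), of j i] by linarith
  have "fdet n ?B = fdet n ?B * fdet n ?C"
    by (simp only: fdet_frob_perm[OF f] mult_1_right)
  also have "\<dots> = fdet n ?D"
    by (rule fdet_mult[symmetric])
  also have "\<dots> = fdet n (\<lambda>i j. ?B i (frob_perm f j) * ?s j)"
    by (intro fdet_cong D)
  also have "\<dots> = fdet d (\<lambda>i j. ?B i (frob_perm f j) * ?s j) *
      fdet m (\<lambda>i j. ?B (d + i) (frob_perm f (d + j)) * ?s (d + j))"
    unfolding m by (rule fdet_block_upper) (use lower_left d in \<open>auto simp: frob_perm_def\<close>)
  also have "fdet m (\<lambda>i j. ?B (d + i) (frob_perm f (d + j)) * ?s (d + j)) =
      fdet m (\<lambda>i j. if i = j then 1 else 0)"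
    by (intro fdet_cong) (use inj d in \<open>auto simp: frob_perm_def\<close>)
  also have "fdet d (\<lambda>i j. ?B i (frob_perm f j) * ?s j) =
      fdet d (\<lambda>i j. (-1) ^ leg f j * V i (leg f j))"
    by (intro fdet_cong) (use d in \<open>auto simp: frob_perm_def\<close>)
  finally show ?thesis by simp
qed

section \<open>The Giambelli formula for ratios of determinants\<close>

lemma row_length_hook: "row_length (hook p q) i = (if i = 0 then p + 1 else if i \<le> q then 1 else 0)"
  by (cases i) (auto simp: row_length_def hook_def)

lemma antimono_row_length_hook: "antimono (row_length (hook p q))"
  by (rule antimonoI) (auto simp: row_length_hook)

lemma leg_hook: "leg (row_length (hook p q)) 0 = q"
proof -
  have "{i. 0 < i \<and> 0 < row_length (hook p q) i} = {0<..q}"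
    by (auto simp: row_length_hook)
  then show ?thesis by (simp add: leg_def)
qed

text \<open>Expressing the rows \<open>m e\<close> in the basis \<open>m (N - 1), \<dots>, m 0\<close> turns the numerator for \<open>f\<close>
  into a minor of the coefficient matrix, up to sign; for hooks the minor is a single entry.\<close>
lemma giambelli_ratio:
  fixes m :: "nat \<Rightarrow> nat \<Rightarrow> 'a::field" and N :: nat
  defines "R \<equiv> \<lambda>f. fdet N (\<lambda>j l. m (f j + (N - Suc j)) l) / fdet N (\<lambda>j l. m (N - Suc j) l)"
  assumes nz: "fdet N (\<lambda>j l. m (N - Suc j) l) \<noteq> 0"
    and f: "antimono f" "\<forall>i\<ge>N. f i = 0" and d: "\<And>i. i < d \<longleftrightarrow> i < f i"
  shows "R f = fdet d (\<lambda>i j. R (row_length (hook (f i - Suc i) (leg f j))))"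
proof -
  let ?D = "fdet N (\<lambda>j l. m (N - Suc j) l)"
  \<comment> \<open>By Cramer's rule, \<open>v e k\<close> is the coefficient of
    \<open>m (N - Suc k)\<close> in \<open>m e\<close>.\<close>
  define v where "v e k = fdet N (\<lambda>r. if r = k then m e else m (N - Suc r)) / ?D" for e k
  have v: "(\<Sum>k<N. v e k * m (N - Suc k) l) = m e l" if "l < N" for e l
    using fdet_cramer_row[OF that, of "m e" "\<lambda>r. m (N - Suc r)"] nz
    by (simp add: v_def field_simps flip: sum_divide_distrib)
  have R: "R g = fdet b (\<lambda>i j. (-1) ^ leg g j * v (N + (g i - Suc i)) (leg g j))"
    if g: "antimono g" "\<forall>i\<ge>N. g i = 0" and b: "\<And>i. i < b \<longleftrightarrow> i < g i" for g b
  proof -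
    let ?B = "\<lambda>i j. if i < b then v (N + (g i - Suc i)) j else if j = i - g i then 1 else 0"
    have "fdet N (\<lambda>j l. m (g j + (N - Suc j)) l) =
        fdet N (\<lambda>j l. \<Sum>k<N. ?B j k * m (N - Suc k) l)"
    proof (rule fdet_cong)
      fix j l assume jl: "j < N" "l < N"
      show "m (g j + (N - Suc j)) l = (\<Sum>k<N. ?B j k * m (N - Suc k) l)"
      proof (cases "j < b")
        case True
        \<comment> \<open>Rows with a diagonal box have an exponent of at least \<open>N\<close>;
          the excess is the arm length.\<close>
        then have "g j + (N - Suc j) = N + (g j - Suc j)"
          using b[of j] jl by linarith
        then show ?thesis
          using True v[OF jl(2)] by simp
      next
        case False
        then have "(\<Sum>k<N. ?B j k * m (N - Suc k) l) =
            (\<Sum>k<N. if k = j - g j then m (N - Suc k) l else 0)"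
          by (intro sum.cong) auto
        also have "\<dots> = m (N - Suc (j - g j)) l"
          using jl by simp
        \<comment> \<open>A row without diagonal box has an exponent below \<open>N\<close>, so it
          is a basis row itself, the one with index \<open>j - g j\<close>.\<close>
        also have "N - Suc (j - g j) = g j + (N - Suc j)"
          using False b[of j] jl by linarith
        finally show ?thesis ..
      qed
    qed
    also have "\<dots> = fdet b (\<lambda>i j. (-1) ^ leg g j * v (N + (g i - Suc i)) (leg g j)) * ?D"
      unfolding fdet_mult fdet_frobenius[OF g b] ..
    finally show ?thesis
      using nz by (simp add: R_def)
  qed
  \<comment> \<open>The Frobenius rank of a hook is 1, so \<open>R\<close> gives a 1 by 1
    determinant; \<open>q < N\<close> ensures that the hook has at most \<open>N\<close>
    rows.\<close>
  have hook: "R (row_length (hook p q)) = (-1) ^ q * v (N + p) q" if "q < N" for p q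
  proof -
    have "R (row_length (hook p q)) = fdet (Suc 0) (\<lambda>i j. (-1) ^ leg (row_length (hook p q)) j *
        v (N + (row_length (hook p q) i - Suc i)) (leg (row_length (hook p q)) j))"
      using that by (intro R antimono_row_length_hook) (auto simp: row_length_hook)
    also have "\<dots> = (-1) ^ q * v (N + p) q"
      by (subst fdet_expand_row[of 0]) (simp_all add: leg_hook row_length_hook)
    finally show ?thesis .
  qed
  have leg: "leg f j < N" if "j < d" for j
  proof (rule leg_less[OF f])
    show "j < N"
      using that d[of j] f(2) by (cases "j < N") auto
  qed
  show ?thesis
    unfolding R[OF f d] by (intro fdet_cong) (simp add: hook leg)
qed

section \<open>Frobenius coordinates of a Young diagram\<close>

lemma mem_boxes_iff: "(i, j) \<in> boxes lam \<longleftrightarrow> j < row_length lam i"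
  by (simp add: boxes_def row_length_def)

lemma antimono_row_length:
  assumes "young_diagram lam"
  shows "antimono (row_length lam)"
proof (rule antimonoI)
  fix i j :: nat assume "i \<le> j"
  then show "row_length lam j \<le> row_length lam i"
    using assms sorted_wrt_nth_less[of "(\<ge>)" lam i j]
    by (cases "i = j") (auto simp: young_diagram_def row_length_def)
qed

lemma frob_arm_eq: "frob_arm lam i = row_length lam i - Suc i"
proof -
  have "{j. i < j \<and> (i, j) \<in> boxes lam} = {i<..<row_length lam i}"
    by (auto simp: mem_boxes_iff)
  then show ?thesis by (simp add: frob_arm_def)
qed

lemma frob_leg_eq: "frob_leg lam j = leg (row_length lam) j"
  by (simp add: frob_leg_def leg_def mem_boxes_iff)

text \<open>Row lengths decrease weakly while the index grows, so the diagonal boxes form an initial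
  segment of the diagonal. It ends before the least index \<open>d\<close> without a box, and its
  size is the rank.\<close>

lemma less_frob_rank_iff:
  assumes "young_diagram lam"
  shows "i < frob_rank lam \<longleftrightarrow> i < row_length lam i"
proof -
  define d where "d = (LEAST i. \<not> i < row_length lam i)"
  have "\<not> length lam < row_length lam (length lam)"
    by (simp add: row_length_def)
  then have d: "\<not> d < row_length lam d"
    unfolding d_def by (rule LeastI)
  have iff: "j < row_length lam j \<longleftrightarrow> j < d" for j
  proof
    assume "j < row_length lam j"
    show "j < d"
    proof (rule ccontr)
      assume "\<not> j < d"
      then have "row_length lam j \<le> row_length lam d"
        by (intro antimonoD[OF antimono_row_length[OF assms]]) simp
      with \<open>j < row_length lam j\<close> \<open>\<not> j < d\<close> d show False by linarith
    qed
  next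
    assume "j < d"
    then show "j < row_length lam j"
      unfolding d_def using not_less_Least by blast
  qed
  have "frob_rank lam = card {..<d}"
    unfolding frob_rank_def mem_boxes_iff iff lessThan_def ..
  then show ?thesis
    by (simp add: iff)
qed

section \<open>Alternants and moments\<close>

lemma borel_measurable_fdet [measurable (raw)]:
  fixes a :: "nat \<Rightarrow> nat \<Rightarrow> 'b \<Rightarrow> real"
  assumes "\<And>i j. i < n \<Longrightarrow> j < n \<Longrightarrow> a i j \<in> borel_measurable M"
  shows "(\<lambda>x. fdet n (\<lambda>i j. a i j x)) \<in> borel_measurable M"
  unfolding fdet_leibniz
  by (intro borel_measurable_sum borel_measurable_times borel_measurable_const
      borel_measurable_prod assms) (auto dest: permutes_in_image)

text \<open>Tonelli's theorem for the indicator of the exceptional set: it is null iff almost all of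
  its sections are null.\<close>

lemma (in product_sigma_finite) AE_PiM_insert:
  assumes J: "finite J" "i \<notin> J"
    and Q[measurable]: "Measurable.pred (Pi\<^sub>M (insert i J) M) Q"
  shows "(AE x in Pi\<^sub>M (insert i J) M. Q x) \<longleftrightarrow> (AE x in Pi\<^sub>M J M. AE t in M i. Q (x(i := t)))"
proof -
  interpret i: sigma_finite_measure "M i" by (rule sigma_finite_measures)
  have eq: "(\<integral>\<^sup>+t. indicator {x. \<not> Q x} (x(i := t)) \<partial>M i) = 0 \<longleftrightarrow> (AE t in M i. Q (x(i := t)))"
    if "x \<in> space (Pi\<^sub>M J M)" for x
  proof -
    have [measurable]: "(\<lambda>t. x(i := t)) \<in> measurable (M i) (Pi\<^sub>M (insert i J) M)"
      using measurable_component_update[OF that J(2)] .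
    show ?thesis
      by (subst nn_integral_0_iff_AE) (auto simp: indicator_def)
  qed
  have "(AE x in Pi\<^sub>M (insert i J) M. Q x) \<longleftrightarrow>
      (\<integral>\<^sup>+x. indicator {x. \<not> Q x} x \<partial>Pi\<^sub>M (insert i J) M) = 0"
    by (subst AE_iff_nn_integral) auto
  also have "\<dots> \<longleftrightarrow> (\<integral>\<^sup>+x. \<integral>\<^sup>+t. indicator {x. \<not> Q x} (x(i := t)) \<partial>M i \<partial>Pi\<^sub>M J M) = 0"
    by (subst product_nn_integral_insert[OF J]) auto
  also have "\<dots> \<longleftrightarrow> (AE x in Pi\<^sub>M J M. (\<integral>\<^sup>+t. indicator {x. \<not> Q x} (x(i := t)) \<partial>M i) = 0)"
    by (subst nn_integral_0_iff_AE) auto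
  also have "\<dots> \<longleftrightarrow> (AE x in Pi\<^sub>M J M. AE t in M i. Q (x(i := t)))"
    by (intro AE_cong eq)
  finally show ?thesis .
qed

section \<open>Varying one coordinate under the product Lebesgue measure\<close>

interpretation lborel: product_sigma_finite "\<lambda>_. lborel :: real measure"
  by standard

text \<open>Here \<open>x\<close> still has a coordinate \<open>i\<close>, which the update
  overwrites. The inner condition ignores it, so the hypothesis descends to \<open>J - {i}\<close>,
  where \<open>AE_PiM_insert\<close> applies.\<close>

lemma AE_PiM_lborel_update:
  fixes Q :: "('i \<Rightarrow> real) \<Rightarrow> bool"
  assumes J: "finite J" "i \<in> J" and Q[measurable]: "Measurable.pred (Pi\<^sub>M J (\<lambda>_. lborel)) Q"
    and AE: "AE x in Pi\<^sub>M J (\<lambda>_. lborel). AE t in lborel. Q (x(i := t))"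
  shows "AE x in Pi\<^sub>M J (\<lambda>_. lborel). Q x"
proof -
  define J' where "J' = J - {i}"
  have J': "finite J'" "i \<notin> J'" "J = insert i J'"
    using J by (auto simp: J'_def)
  let ?q = "\<lambda>x. (\<integral>\<^sup>+t. indicator {x. \<not> Q x} (x(i := t)) \<partial>lborel)"
  have upd[measurable]: "(\<lambda>(x, t). x(i := t)) \<in>
      measurable (Pi\<^sub>M J (\<lambda>_. lborel) \<Otimes>\<^sub>M lborel) (Pi\<^sub>M J (\<lambda>_. lborel))"
    using measurable_add_dim[of i J "\<lambda>_. lborel"] J(2) by (simp add: insert_absorb)
  have [measurable]: "?q \<in> borel_measurable (Pi\<^sub>M J (\<lambda>_. lborel))"
    by measurable
  have eq: "?q x = 0 \<longleftrightarrow> (AE t in lborel. Q (x(i := t)))"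
    if "x \<in> space (Pi\<^sub>M J (\<lambda>_. lborel))" for x
  proof -
    have [measurable]: "(\<lambda>t. x(i := t)) \<in> measurable lborel (Pi\<^sub>M J (\<lambda>_. lborel))"
      using measurable_compose[OF measurable_Pair1'[OF that] upd] by simp
    show ?thesis
      by (subst nn_integral_0_iff_AE) (auto simp: indicator_def)
  qed
  have "AE x in Pi\<^sub>M J (\<lambda>_. lborel). ?q x = 0"
    using AE by (subst AE_cong[OF eq]) auto
  then have "AE x in Pi\<^sub>M J' (\<lambda>_. lborel). AE s in lborel. ?q (x(i := s :: real)) = 0"
    unfolding J'(3) by (subst (asm) lborel.AE_PiM_insert[OF J'(1,2)]) (auto simp flip: J'(3))
  \<comment> \<open>Nothing depends on \<open>s\<close> after the second update, and Lebesgue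
    measure is not zero, so the quantifier over \<open>s\<close> disappears.\<close>
  then have "AE x in Pi\<^sub>M J' (\<lambda>_. lborel). ?q x = 0"
    by (simp add: eventually_const_iff ae_filter_eq_bot_iff)
  moreover have "?q x = 0 \<longleftrightarrow> (AE t in lborel. Q (x(i := t)))"
    if "x \<in> space (Pi\<^sub>M J' (\<lambda>_. lborel))" for x
    \<comment> \<open>\<open>eq\<close> is stated for points with a coordinate \<open>i\<close>; the
      inserted value 0 is arbitrary, as it is overwritten.\<close>
    using eq[of "x(i := 0)"] that by (simp add: space_PiM J'(3) PiE_def extensional_def)
  ultimately have "AE x in Pi\<^sub>M J' (\<lambda>_. lborel). AE t in lborel. Q (x(i := t))"
    by (subst (asm) AE_cong) auto
  then show ?thesis
    using Q unfolding J'(3) by (subst lborel.AE_PiM_insert[OF J'(1,2)])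
qed

text \<open>The exponents are distinct, so no other term can cancel \<open>a 0\<close>: the
  polynomial is nonzero and has finitely many roots.\<close>

lemma AE_lborel_sum_monomials_ne_0:
  fixes a :: "nat \<Rightarrow> real"
  assumes "inj_on e {..n}" "a 0 \<noteq> 0"
  shows "AE t in lborel. (\<Sum>j\<le>n. t ^ e j * a j) \<noteq> 0"
proof -
  define p where "p = (\<Sum>j\<le>n. monom (a j) (e j))"
  have "coeff p (e 0) = (\<Sum>j\<le>n. if j = 0 then a j else 0)"
    unfolding p_def coeff_sum using assms(1) by (intro sum.cong) (auto simp: inj_on_def)
  then have "p \<noteq> 0"
    using assms(2) by auto
  then have "finite {t. poly p t = 0}"
    by (rule poly_roots_finite)
  then have "AE t in lborel. t \<notin> {t. poly p t = 0}"
    by (intro AE_not_in finite_imp_null_set_lborel)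
  then show ?thesis
    by (simp add: p_def poly_sum poly_monom mult.commute)
qed

text \<open>Expanded along its last row, the alternant is a polynomial in one coordinate. Its
  coefficient at exponent \<open>e 0\<close> is, up to sign, a smaller alternant in the other
  coordinates. The points are selected by \<open>idx\<close>, so that the induction stays in one
  product space and a coordinate may be omitted later.\<close>

lemma AE_alternant_ne_0:
  fixes idx :: "nat \<Rightarrow> 'i"
  assumes "finite J" "inj_on idx {..<n}" "idx ` {..<n} \<subseteq> J" "inj_on e {..<n}"
  shows "AE x in Pi\<^sub>M J (\<lambda>_. lborel). fdet n (\<lambda>i j. x (idx i) ^ e j :: real) \<noteq> 0"
  using assms(2-)
proof (induction n arbitrary: e)
  case 0
  show ?case by simp
next
  case (Suc n)
  have idx: "idx i \<in> J" if "i \<le> n" for i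
    using Suc.prems(2) that by auto
  have inj_idx: "idx i \<noteq> idx n" if "i < n" for i
    using inj_onD[OF Suc.prems(1), of i n] that by auto
  let ?m = "\<lambda>x j. (-1) ^ (n + j) * fdet n (\<lambda>r c. x (idx r) ^ e (insert_index j c))"
  have meas: "(\<lambda>x. fdet (Suc n) (\<lambda>i j. x (idx i) ^ e j :: real))
      \<in> borel_measurable (Pi\<^sub>M J (\<lambda>_. lborel))"
    using measurable_component_singleton[OF idx, of _ "\<lambda>_. lborel"]
    by (intro borel_measurable_fdet borel_measurable_power) (auto simp: less_Suc_eq_le)
  show ?case
  proof (rule AE_PiM_lborel_update[OF \<open>finite J\<close> idx[OF le_refl]])
    show "Measurable.pred (Pi\<^sub>M J (\<lambda>_. lborel)) (\<lambda>x. fdet (Suc n) (\<lambda>i j. x (idx i) ^ e j :: real) \<noteq> 0)"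
      unfolding pred_def by (intro borel_measurable_neq meas borel_measurable_const)
    have "AE x in Pi\<^sub>M J (\<lambda>_. lborel). fdet n (\<lambda>i j. x (idx i) ^ (e \<circ> Suc) j :: real) \<noteq> 0"
    proof (rule Suc.IH)
      show "inj_on (e \<circ> Suc) {..<n}"
        using Suc.prems(3) by (auto simp: inj_on_def)
    qed (use Suc.prems in \<open>auto intro: inj_on_subset\<close>)
    then show "AE x in Pi\<^sub>M J (\<lambda>_. lborel). AE t in lborel.
        fdet (Suc n) (\<lambda>i j. (x(idx n := t)) (idx i) ^ e j :: real) \<noteq> 0"
    proof eventually_elim
      case (elim x)
      have "fdet (Suc n) (\<lambda>i j. (x(idx n := t)) (idx i) ^ e j) = (\<Sum>j\<le>n. t ^ e j * ?m x j)" for t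
        by (subst fdet_expand_row[OF le_refl], intro sum.cong refl arg_cong2[where f = "(*)"] fdet_cong)
           (auto simp: inj_idx)
      moreover have "?m x 0 \<noteq> 0"
        using elim by simp
      ultimately show ?case
        using AE_lborel_sum_monomials_ne_0[of e n "?m x"] Suc.prems(3)
        by (simp add: lessThan_Suc_atMost)
    qed
  qed
qed

text \<open>The leading term controls the polynomial \<open>p\<close>:
  \<open>\<bar>t\<bar> ^ e 0\<close> is at most a constant times \<open>1 + \<bar>p t\<bar>\<close>,
  and \<open>h\<close> and \<open>p * h\<close> are both integrable.\<close>

lemma integrable_leading_monomial:
  fixes h :: "real \<Rightarrow> real" and e :: "nat \<Rightarrow> nat" and a :: "nat \<Rightarrow> real"
  assumes h: "integrable lborel h"
    and ph: "integrable lborel (\<lambda>t. (\<Sum>j\<le>n. t ^ e j * a j) * h t)"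
    and a: "a 0 \<noteq> 0" and e: "\<And>j. 0 < j \<Longrightarrow> j \<le> n \<Longrightarrow> e j < e 0"
  shows "integrable lborel (\<lambda>t. t ^ e 0 * h t)"
proof -
  let ?p = "\<lambda>t. \<Sum>j\<le>n. t ^ e j * a j"
  \<comment> \<open>For \<open>\<bar>t\<bar> > R\<close> the lower terms add up to at most half of
    the leading one; \<open>R \<ge> 1\<close> lets powers grow with the exponent. \<open>C\<close>
    serves both ranges: \<open>R ^ e 0\<close> inside, \<open>2 / \<bar>a 0\<bar>\<close>
    outside.\<close>
  define S where "S = (\<Sum>j\<in>{0<..n}. \<bar>a j\<bar>)"
  define R where "R = max 1 (2 * S / \<bar>a 0\<bar>)"
  define C where "C = max (R ^ e 0) (2 / \<bar>a 0\<bar>)"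
  have C: "0 \<le> C" unfolding C_def by (rule max.coboundedI2) simp
  have bound: "\<bar>t\<bar> ^ e 0 \<le> C * (1 + \<bar>?p t\<bar>)" for t
  proof (cases "\<bar>t\<bar> \<le> R")
    case True
    then have "\<bar>t\<bar> ^ e 0 \<le> C"
      using power_mono[of "\<bar>t\<bar>" R "e 0"] by (simp add: C_def)
    also have "C \<le> C * (1 + \<bar>?p t\<bar>)"
      using C by (simp add: algebra_simps)
    finally show ?thesis .
  next
    case False
    then have t: "1 < \<bar>t\<bar>" "2 * S / \<bar>a 0\<bar> < \<bar>t\<bar>"
      by (auto simp: R_def)
    have "\<bar>t\<bar> ^ e j \<le> \<bar>t\<bar> ^ e 0 / \<bar>t\<bar>" if "0 < j" "j \<le> n" for j
    proof -
      have "\<bar>t\<bar> ^ Suc (e j) \<le> \<bar>t\<bar> ^ e 0"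
        using t(1) e[OF that] by (intro power_increasing) auto
      then show ?thesis
        using t(1) by (simp add: field_simps)
    qed
    then have "(\<Sum>j\<in>{0<..n}. \<bar>t\<bar> ^ e j * \<bar>a j\<bar>) \<le> (\<Sum>j\<in>{0<..n}. \<bar>t\<bar> ^ e 0 / \<bar>t\<bar> * \<bar>a j\<bar>)"
      by (intro sum_mono mult_right_mono) auto
    also have "\<dots> = \<bar>t\<bar> ^ e 0 / \<bar>t\<bar> * S"
      by (simp add: S_def sum_distrib_left)
    also have "\<dots> \<le> \<bar>t\<bar> ^ e 0 * \<bar>a 0\<bar> / 2"
      using t a mult_left_mono[of "2 * S" "\<bar>t\<bar> * \<bar>a 0\<bar>" "\<bar>t\<bar> ^ e 0"] by (simp add: field_simps)
    finally have rest: "(\<Sum>j\<in>{0<..n}. \<bar>t\<bar> ^ e j * \<bar>a j\<bar>) \<le> \<bar>t\<bar> ^ e 0 * \<bar>a 0\<bar> / 2" .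
    have "{..n} = insert 0 {0<..n}" by auto
    then have "?p t = t ^ e 0 * a 0 + (\<Sum>j\<in>{0<..n}. t ^ e j * a j)"
      by simp
    moreover have "\<bar>\<Sum>j\<in>{0<..n}. t ^ e j * a j\<bar> \<le> (\<Sum>j\<in>{0<..n}. \<bar>t\<bar> ^ e j * \<bar>a j\<bar>)"
      by (rule order.trans[OF sum_abs]) (simp add: abs_mult power_abs)
    moreover have "\<bar>t ^ e 0 * a 0\<bar> = \<bar>t\<bar> ^ e 0 * \<bar>a 0\<bar>"
      by (simp add: abs_mult power_abs)
    ultimately have "\<bar>t\<bar> ^ e 0 * \<bar>a 0\<bar> / 2 \<le> \<bar>?p t\<bar>"
      using rest by linarith
    then have "\<bar>t\<bar> ^ e 0 \<le> 2 / \<bar>a 0\<bar> * \<bar>?p t\<bar>"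
      using a by (simp add: field_simps)
    also have "\<dots> \<le> C * (1 + \<bar>?p t\<bar>)"
      using C by (intro mult_mono) (auto simp: C_def)
    finally show ?thesis .
  qed
  have [measurable]: "h \<in> borel_measurable borel"
    using h by (simp add: borel_measurable_integrable)
  show ?thesis
  proof (rule Bochner_Integration.integrable_bound)
    show "integrable lborel (\<lambda>t. C * (\<bar>h t\<bar> + \<bar>?p t * h t\<bar>))"
      using h ph by auto
    show "AE t in lborel. norm (t ^ e 0 * h t) \<le> norm (C * (\<bar>h t\<bar> + \<bar>?p t * h t\<bar>))"
    proof (intro AE_I2)
      fix t
      have "norm (t ^ e 0 * h t) = \<bar>t\<bar> ^ e 0 * \<bar>h t\<bar>"
        by (simp add: abs_mult power_abs)
      also have "\<dots> \<le> C * (1 + \<bar>?p t\<bar>) * \<bar>h t\<bar>"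
        by (intro mult_right_mono bound) simp
      also have "\<dots> = C * (\<bar>h t\<bar> + \<bar>?p t * h t\<bar>)"
        by (simp add: abs_mult algebra_simps)
      finally show "norm (t ^ e 0 * h t) \<le> norm (C * (\<bar>h t\<bar> + \<bar>?p t * h t\<bar>))"
        by (simp add: C)
    qed
  qed measurable
qed

text \<open>Both determinants are expanded by the Leibniz formula, and each term integrates to a
  product of one-dimensional integrals. The assumption \<open>int\<close> makes every term
  integrable.\<close>

lemma integral_andreief:
  fixes f \<psi> :: "nat \<Rightarrow> real \<Rightarrow> real"
  assumes int: "\<And>i l. i < N \<Longrightarrow> l < N \<Longrightarrow> integrable lborel (\<lambda>t. f i t * \<psi> l t)"
  shows "(LINT x|lborel_pow N. fdet N (\<lambda>i j. f j (x i)) * fdet N (\<lambda>i l. \<psi> l (x i))) =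
    fact N * fdet N (\<lambda>j l. LINT t|lborel. f j t * \<psi> l t)"
proof -
  let ?P = "{p. p permutes {..<N}}"
  let ?m = "\<lambda>j l. LINT t|lborel. f j t * \<psi> l t"
  have int': "integrable lborel (\<lambda>t. f (s i) t * \<psi> (p i) t)"
    if "s \<in> ?P" "p \<in> ?P" "i \<in> {..<N}" for s p i
    using that permutes_in_image[of s "{..<N}" i] permutes_in_image[of p "{..<N}" i]
    by (intro int) auto
  have intp: "integrable (lborel_pow N) (\<lambda>x. \<Prod>i<N. f (s i) (x i) * \<psi> (p i) (x i))"
    if "s \<in> ?P" "p \<in> ?P" for s p
    using lborel.product_integrable_prod[OF finite_lessThan int'[OF that]] .
  have "(LINT x|lborel_pow N. fdet N (\<lambda>i j. f j (x i)) * fdet N (\<lambda>i l. \<psi> l (x i))) =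
      (LINT x|lborel_pow N. (\<Sum>s\<in>?P. \<Sum>p\<in>?P. of_int (sign s) * (of_int (sign p) *
        (\<Prod>i<N. f (s i) (x i) * \<psi> (p i) (x i)))))"
    unfolding fdet_leibniz sum_product
    by (intro Bochner_Integration.integral_cong refl sum.cong) (simp add: prod.distrib mult_ac)
  also have "\<dots> = (\<Sum>s\<in>?P. (LINT x|lborel_pow N. (\<Sum>p\<in>?P. of_int (sign s) * (of_int (sign p) *
        (\<Prod>i<N. f (s i) (x i) * \<psi> (p i) (x i))))))"
    by (intro Bochner_Integration.integral_sum Bochner_Integration.integrable_sum
        integrable_mult_right intp)
  also have "\<dots> = (\<Sum>s\<in>?P. \<Sum>p\<in>?P. (LINT x|lborel_pow N. of_int (sign s) * (of_int (sign p) *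
        (\<Prod>i<N. f (s i) (x i) * \<psi> (p i) (x i)))))"
    by (intro sum.cong refl Bochner_Integration.integral_sum integrable_mult_right intp)
  also have "\<dots> = (\<Sum>s\<in>?P. \<Sum>p\<in>?P. of_int (sign s) * (of_int (sign p) *
        (LINT x|lborel_pow N. (\<Prod>i<N. f (s i) (x i) * \<psi> (p i) (x i)))))"
    by simp
  also have "\<dots> = (\<Sum>s\<in>?P. \<Sum>p\<in>?P. of_int (sign s) * (of_int (sign p) *
        (\<Prod>i<N. ?m (s i) (p i))))"
    by (intro sum.cong refl arg_cong2[where f = "(*)"] lborel.product_integral_prod int') auto
  also have "\<dots> = (\<Sum>s\<in>?P. of_int (sign s) * fdet N (\<lambda>i. ?m (s i)))"
    by (simp add: fdet_leibniz sum_distrib_left)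
  \<comment> \<open>Permuting the rows by \<open>s\<close> produces a second factor
    \<open>sign s\<close>, so all summands coincide.\<close>
  also have "\<dots> = (\<Sum>s\<in>?P. fdet N ?m)"
    by (intro sum.cong refl)
       (auto simp: fdet_permute_rows[of _ N ?m] sign_def)
  also have "\<dots> = fact N * fdet N ?m"
    by (simp add: card_permutations[of "{..<N}" N])
  finally show ?thesis .
qed

text \<open>The section part of Fubini's theorem, with the remaining coordinates taken from a point
  of the full product.\<close>

lemma AE_integrable_update:
  fixes F :: "('i \<Rightarrow> real) \<Rightarrow> real"
  assumes J: "finite J" "i \<in> J" and F: "integrable (Pi\<^sub>M J (\<lambda>_. lborel)) F"
  shows "AE x in Pi\<^sub>M J (\<lambda>_. lborel). integrable lborel (\<lambda>t. F (x(i := t)))"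
proof -
  define J' where "J' = J - {i}"
  have J': "finite J'" "i \<notin> J'" "J = insert i J'"
    using J by (auto simp: J'_def)
  have [measurable]: "F \<in> borel_measurable (Pi\<^sub>M J (\<lambda>_. lborel))"
    using F by auto
  have upd[measurable]: "(\<lambda>(x, t). x(i := t)) \<in>
      measurable (Pi\<^sub>M J (\<lambda>_. lborel) \<Otimes>\<^sub>M lborel) (Pi\<^sub>M J (\<lambda>_. lborel))"
    using measurable_add_dim[of i J "\<lambda>_. lborel"] J(2) by (simp add: insert_absorb)
  have upd': "(\<lambda>t. x(i := t)) \<in> measurable lborel (Pi\<^sub>M J (\<lambda>_. lborel))"
    if "x \<in> space (Pi\<^sub>M J (\<lambda>_. lborel))" for x
    using measurable_compose[OF measurable_Pair1'[OF that] upd] by simp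
  let ?n = "\<lambda>x. \<integral>\<^sup>+t. ennreal (norm (F (x(i := t)))) \<partial>lborel"
  have [measurable]: "?n \<in> borel_measurable (Pi\<^sub>M J (\<lambda>_. lborel))"
    by measurable
  have [measurable]: "F \<in> borel_measurable (Pi\<^sub>M (insert i J') (\<lambda>_. lborel))"
    by (simp flip: J'(3))
  have n_measurable: "?n \<in> borel_measurable (Pi\<^sub>M J' (\<lambda>_. lborel))"
    using J'(2) by measurable
  have "(\<integral>\<^sup>+x. ?n x \<partial>Pi\<^sub>M J' (\<lambda>_. lborel)) = (\<integral>\<^sup>+x. norm (F x) \<partial>Pi\<^sub>M J (\<lambda>_. lborel))"
    unfolding J'(3) by (subst lborel.product_nn_integral_insert[OF J'(1,2)]) auto
  also have "\<dots> \<noteq> \<infinity>"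
    using F by (simp add: integrable_iff_bounded)
  finally have "AE x in Pi\<^sub>M J' (\<lambda>_. lborel). ?n x \<noteq> \<infinity>"
    by (rule nn_integral_PInf_AE[OF n_measurable])
  \<comment> \<open>\<open>?n\<close> ignores coordinate \<open>i\<close>, so finiteness passes back
    from \<open>J'\<close> to the full product.\<close>
  then have "AE x in Pi\<^sub>M (insert i J') (\<lambda>_. lborel). ?n x \<noteq> \<infinity>"
    by (subst lborel.AE_PiM_insert[OF J'(1,2)]) (auto simp flip: J'(3))
  then have "AE x in Pi\<^sub>M J (\<lambda>_. lborel). ?n x \<noteq> \<infinity>"
    by (subst J'(3))
  then show ?thesis
    by (rule AE_mp[OF _ AE_I2])
       (auto simp: integrable_iff_bounded less_top intro: measurable_compose[OF upd'])
qed

text \<open>\<open>e 0\<close> is the largest exponent, so it is the degree of the first factor in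
  each single coordinate; \<open>nz\<close> provides points at which Cramer's rule can be
  applied.\<close>

lemma integrable_moment:
  fixes \<psi> :: "nat \<Rightarrow> real \<Rightarrow> real"
  assumes \<psi>: "\<And>l. l < N \<Longrightarrow> integrable lborel (\<psi> l)"
    and e: "inj_on e {..<N}" "\<And>j. 0 < j \<Longrightarrow> j < N \<Longrightarrow> e j < e 0"
    and F: "integrable (lborel_pow N)
      (\<lambda>x. fdet N (\<lambda>i j. x i ^ e j) * fdet N (\<lambda>i l. \<psi> l (x i)))"
    and nz: "\<not> (AE x in lborel_pow N. fdet N (\<lambda>i l. \<psi> l (x i)) = 0)"
    and l: "l < N"
  shows "integrable lborel (\<lambda>t. t ^ e 0 * \<psi> l t)"
proof -
  obtain n where N: "N = Suc n"
    using l by (cases N) auto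
  let ?F = "\<lambda>x. fdet N (\<lambda>i j. x i ^ e j) * fdet N (\<lambda>i l. \<psi> l (x i))"
  let ?c = "\<lambda>x i j. (-1) ^ (i + j) * fdet n (\<lambda>r c. x (insert_index i r) ^ e (insert_index j c))"
  have "AE x in lborel_pow N. \<forall>i\<in>{..<N}. integrable lborel (\<lambda>t. ?F (x(i := t)))"
    using F by (intro AE_finite_allI AE_integrable_update) auto
  moreover have "AE x in lborel_pow N. \<forall>i\<in>{..<N}. ?c x i 0 \<noteq> 0"
  proof (intro AE_finite_allI finite_lessThan)
    fix i assume i: "i \<in> {..<N}"
    \<comment> \<open>The coefficient of the top power omits column 0, which leaves the exponents
      \<open>e \<circ> Suc\<close>, and point \<open>i\<close>.\<close>
    have "AE x in lborel_pow N. fdet n (\<lambda>r c. x (insert_index i r) ^ (e \<circ> Suc) c :: real) \<noteq> 0"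
      using i e(1) by (intro AE_alternant_ne_0) (auto simp: N insert_index_def inj_on_def)
    then show "AE x in lborel_pow N. ?c x i 0 \<noteq> 0"
      by simp
  qed
  ultimately have "AE x in lborel_pow N. \<forall>i\<in>{..<N}.
      integrable lborel (\<lambda>t. ?F (x(i := t))) \<and> ?c x i 0 \<noteq> 0"
    by eventually_elim auto
  \<comment> \<open>The listed conditions hold almost everywhere and the second factor is nonzero on
    a set that is not null, so some configuration satisfies both.\<close>
  then obtain x where x: "\<And>i. i < N \<Longrightarrow> integrable lborel (\<lambda>t. ?F (x(i := t)))"
      "\<And>i. i < N \<Longrightarrow> ?c x i 0 \<noteq> 0"
    and D: "fdet N (\<lambda>i l. \<psi> l (x i)) \<noteq> 0"
  proof -
    have "\<exists>x. (\<forall>i\<in>{..<N}. integrable lborel (\<lambda>t. ?F (x(i := t))) \<and> ?c x i 0 \<noteq> 0) \<and>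
        fdet N (\<lambda>i l. \<psi> l (x i)) \<noteq> 0" (is "\<exists>x. ?P x \<and> ?d x \<noteq> 0")
    proof (rule ccontr)
      assume "\<nexists>x. ?P x \<and> ?d x \<noteq> 0"
      then have "?d x = 0" if "?P x" for x
        using that by blast
      with \<open>AE x in lborel_pow N. ?P x\<close> have "AE x in lborel_pow N. ?d x = 0"
        by (rule eventually_mono)
      with nz show False ..
    qed
    with that show thesis by blast
  qed
  let ?D = "fdet N (\<lambda>i l. \<psi> l (x i))"
  \<comment> \<open>The second factor with point \<open>i\<close> moved to \<open>t\<close>; it is a
    fixed linear combination of the \<open>\<psi> l t\<close>.\<close>
  define h where "h i t = fdet N (\<lambda>r. if r = i then (\<lambda>l. \<psi> l t) else (\<lambda>l. \<psi> l (x r)))" for i t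
  have h: "integrable lborel (h i)" if "i < N" for i
    unfolding h_def using \<psi> by (subst fdet_replace_row[OF that]) auto
  have moment_h: "integrable lborel (\<lambda>t. t ^ e 0 * h i t)" if i: "i < N" for i
  proof (rule integrable_leading_monomial[OF h[OF i]])
    have eq: "?F (x(i := t)) = (\<Sum>j\<le>n. t ^ e j * ?c x i j) * h i t" for t
    proof -
      have "fdet N (\<lambda>r j. (x(i := t)) r ^ e j) = (\<Sum>j\<le>n. t ^ e j * ?c x i j)"
        unfolding N using i
        by (subst fdet_expand_row[of i]) (auto simp: N intro!: sum.cong fdet_cong)
      moreover have "fdet N (\<lambda>r l. \<psi> l ((x(i := t)) r)) = h i t"
        unfolding h_def by (rule fdet_cong) auto
      ultimately show ?thesis by simp
    qed
    show "integrable lborel (\<lambda>t. (\<Sum>j\<le>n. t ^ e j * ?c x i j) * h i t)"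
      using x(1)[OF i] unfolding eq .
    show "?c x i 0 \<noteq> 0"
      using x(2)[OF i] .
    show "e j < e 0" if "0 < j" "j \<le> n" for j
      using e(2) that by (simp add: N)
  qed
  \<comment> \<open>Cramer's rule with determinant \<open>?D \<noteq> 0\<close> recovers
    \<open>\<psi> l\<close> from the functions \<open>h i\<close>.\<close>
  have "t ^ e 0 * \<psi> l t = (\<Sum>i<N. t ^ e 0 * h i t * (\<psi> l (x i) / ?D))" for t
    using fdet_cramer_row[OF l, of "\<lambda>l. \<psi> l t" "\<lambda>i l. \<psi> l (x i)"] D
    by (simp add: h_def field_simps flip: sum_distrib_left sum_divide_distrib)
  then show ?thesis
    using moment_h by auto
qed

section \<open>Expectations in a polynomial ensemble\<close>

text \<open>Domination by \<open>\<bar>t\<bar> ^ k \<le> 1 + \<bar>t\<bar> ^ K\<close>.\<close>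

lemma integrable_lower_moment:
  fixes h :: "real \<Rightarrow> real"
  assumes "integrable lborel h" "integrable lborel (\<lambda>t. t ^ K * h t)" "k \<le> K"
  shows "integrable lborel (\<lambda>t. t ^ k * h t)"
proof (rule Bochner_Integration.integrable_bound)
  show "integrable lborel (\<lambda>t. \<bar>h t\<bar> + \<bar>t ^ K * h t\<bar>)"
    using assms by auto
  show "(\<lambda>t. t ^ k * h t) \<in> borel_measurable lborel"
    using assms(1) by auto
  show "AE t in lborel. norm (t ^ k * h t) \<le> norm (\<bar>h t\<bar> + \<bar>t ^ K * h t\<bar>)"
  proof (intro AE_I2)
    fix t :: real
    have "\<bar>t\<bar> ^ k \<le> 1 + \<bar>t\<bar> ^ K"
    proof (cases "\<bar>t\<bar> \<le> 1")
      case True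
      then have "\<bar>t\<bar> ^ k \<le> 1" by (intro power_le_one) auto
      then show ?thesis by (simp add: add_increasing2)
    next
      case False
      then have "\<bar>t\<bar> ^ k \<le> \<bar>t\<bar> ^ K" using assms(3) by (intro power_increasing) auto
      then show ?thesis by simp
    qed
    then have "\<bar>t\<bar> ^ k * \<bar>h t\<bar> \<le> (1 + \<bar>t\<bar> ^ K) * \<bar>h t\<bar>"
      by (intro mult_right_mono) auto
    then show "norm (t ^ k * h t) \<le> norm (\<bar>h t\<bar> + \<bar>t ^ K * h t\<bar>)"
      by (simp add: abs_mult power_abs algebra_simps)
  qed
qed

context
  fixes N :: nat and I :: "real set" and \<phi> :: "nat \<Rightarrow> real \<Rightarrow> real"
  assumes pe: "polynomial_ensemble N I \<phi>"
begin

text \<open>Cutting off each \<open>\<phi> l\<close> at \<open>I\<close> absorbs the indicator of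
  \<open>I^N\<close> into the determinant, so that all integrals run over the whole space.\<close>

private abbreviation "\<psi> \<equiv> \<lambda>l t. indicator I t * \<phi> l t"
private abbreviation "\<Psi> \<equiv> \<lambda>x. fdet N (\<lambda>i l. \<psi> l (x i))"
private abbreviation "Z \<equiv> pe_norm N I \<phi>"
private abbreviation "moment \<equiv> \<lambda>k l. LINT t|lborel. t ^ k * \<psi> l t"
private abbreviation "alternant \<equiv> \<lambda>f x. fdet N (\<lambda>i j. x i ^ (f j + (N - Suc j)))"

private lemma integrable_\<psi>: "l < N \<Longrightarrow> integrable lborel (\<psi> l)"
  using pe by (simp add: polynomial_ensemble_def set_integrable_def)

private lemma Z_ne_0: "Z \<noteq> 0"
  using pe by (simp add: polynomial_ensemble_def)

private lemma measurable_component [measurable]: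
  "i < N \<Longrightarrow> (\<lambda>x. x i) \<in> borel_measurable (lborel_pow N)"
  using measurable_component_singleton[of i "{..<N}" "\<lambda>_. lborel"] by simp

private lemma measurable_\<Psi> [measurable]: "\<Psi> \<in> borel_measurable (lborel_pow N)"
proof (rule borel_measurable_fdet)
  fix i l assume "i < N" "l < N"
  then show "(\<lambda>x. \<psi> l (x i)) \<in> borel_measurable (lborel_pow N)"
    using integrable_\<psi>[of l] by (intro measurable_compose[OF measurable_component]) auto
qed

private lemma measurable_alternant [measurable]: "alternant f \<in> borel_measurable (lborel_pow N)"
  by (intro borel_measurable_fdet borel_measurable_power measurable_component)

private lemma vandermonde_eq: "vandermonde N = alternant (\<lambda>_. 0)"
  by (simp add: fdet_vandermonde)

private lemma measurable_vandermonde [measurable]: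
  "vandermonde N \<in> borel_measurable (lborel_pow N)"
  unfolding vandermonde_eq by measurable

private lemma AE_vandermonde_ne_0: "AE x in lborel_pow N. vandermonde N x \<noteq> 0"
proof -
  have "inj_on (\<lambda>j. N - Suc j) {..<N}"
    by (rule inj_onI) (unfold lessThan_iff, linarith)
  then have "AE x in lborel_pow N. alternant (\<lambda>_. 0) x \<noteq> 0"
    using AE_alternant_ne_0[of "{..<N}" "\<lambda>i. i" N "\<lambda>j. N - Suc j"] by simp
  then show ?thesis by (simp only: vandermonde_eq)
qed

text \<open>Outside \<open>I^N\<close> some point lies outside \<open>I\<close>, which makes a whole
  row of the cut-off determinant zero.\<close>

private lemma indicator_pe_weight:
  assumes "x \<in> space (lborel_pow N)"
  shows "indicator (set_pow I N) x * pe_weight N \<phi> x = vandermonde N x * \<Psi> x"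
proof (cases "x \<in> set_pow I N")
  case True
  have "x i \<in> I" if "i < N" for i
    using PiE_mem[OF True, of i] that by simp
  then have "\<Psi> x = fdet N (\<lambda>i l. \<phi> l (x i))"
    by (intro fdet_cong) simp
  with True show ?thesis
    by (simp add: pe_weight_def fdet_def)
next
  case False
  then obtain i where i: "i < N" "x i \<notin> I"
    using assms by (auto simp: space_PiM PiE_iff)
  then have "(\<Prod>r<N. \<psi> (p r) (x r)) = 0" for p
    by (intro prod_zero bexI[of _ i]) auto
  then have "\<Psi> x = 0"
    unfolding fdet_leibniz by (simp only: mult_zero_right sum.neutral_const)
  with False show ?thesis by simp
qed

private lemma integrable_weight: "integrable (lborel_pow N) (\<lambda>x. vandermonde N x * \<Psi> x)"
  using pe by (simp add: polynomial_ensemble_def set_integrable_def indicator_pe_weight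
      cong: Bochner_Integration.integrable_cong)

private lemma Z_eq: "Z = (LINT x|lborel_pow N. vandermonde N x * \<Psi> x)"
  by (simp add: pe_norm_def set_lebesgue_integral_def indicator_pe_weight
      cong: Bochner_Integration.integral_cong)

text \<open>Otherwise the normalisation constant would vanish. This supplies the hypothesis
  \<open>nz\<close> of \<open>integrable_moment\<close>.\<close>

private lemma not_AE_\<Psi>_eq_0: "\<not> (AE x in lborel_pow N. \<Psi> x = 0)"
proof
  assume "AE x in lborel_pow N. \<Psi> x = 0"
  then have "AE x in lborel_pow N. vandermonde N x * \<Psi> x = 0"
    by eventually_elim simp
  then have "Z = 0"
    unfolding Z_eq by (rule integral_eq_zero_AE)
  with Z_ne_0 show False ..
qed

section \<open>The density and the probability measure of the ensemble\<close>

private abbreviation "\<rho> \<equiv> \<lambda>x. vandermonde N x * \<Psi> x / Z"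

private lemma indicator_pe_density:
  "x \<in> space (lborel_pow N) \<Longrightarrow> indicator (set_pow I N) x * pe_density N I \<phi> x = \<rho> x"
  using indicator_pe_weight[of x] by (simp add: pe_density_def)

private lemma pe_measure_eq: "pe_measure N I \<phi> = density (lborel_pow N) (\<lambda>x. ennreal (\<rho> x))"
proof -
  \<comment> \<open>The \<open>\<phi> l\<close> are known to be measurable only after the cut-off,
    so measurability is taken over from \<open>\<rho>\<close>.\<close>
  have "(\<lambda>x. ennreal (indicator (set_pow I N) x * pe_density N I \<phi> x))
      \<in> borel_measurable (lborel_pow N)"
    by (subst measurable_cong[OF arg_cong[where f = ennreal, OF indicator_pe_density]]) auto
  then show ?thesis
    unfolding pe_measure_def by (intro density_cong) (auto simp: indicator_pe_density)
qed

private lemma AE_\<rho>_nonneg: "AE x in lborel_pow N. 0 \<le> \<rho> x"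
proof -
  have "AE x in lborel_pow N. x \<in> set_pow I N \<longrightarrow> 0 \<le> pe_density N I \<phi> x"
    using pe by (simp add: polynomial_ensemble_def)
  then have "AE x in lborel_pow N. 0 \<le> indicator (set_pow I N) x * pe_density N I \<phi> x"
    by eventually_elim (auto simp: indicator_def)
  then show ?thesis
    by (subst (asm) AE_cong) (auto simp: indicator_pe_density)
qed

lemma prob_space_pe_measure: "prob_space (pe_measure N I \<phi>)"
proof
  have "emeasure (pe_measure N I \<phi>) (space (pe_measure N I \<phi>)) =
      (\<integral>\<^sup>+x. ennreal (\<rho> x) \<partial>lborel_pow N)"
    by (simp add: pe_measure_eq emeasure_density cong: nn_integral_cong)
  also have "\<dots> = ennreal (LINT x|lborel_pow N. \<rho> x)"
    using integrable_weight AE_\<rho>_nonneg by (intro nn_integral_eq_integral) auto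
  also have "(LINT x|lborel_pow N. \<rho> x) = 1"
    using Z_ne_0 by (simp flip: Z_eq)
  finally show "emeasure (pe_measure N I \<phi>) (space (pe_measure N I \<phi>)) = 1" by simp
qed

lemma AE_pe_measure_set_pow: "AE x in pe_measure N I \<phi>. x \<in> set_pow I N"
proof -
  have "x \<in> set_pow I N" if "x \<in> space (lborel_pow N)" "0 < \<rho> x" for x
  proof (rule ccontr)
    assume "x \<notin> set_pow I N"
    then have "\<rho> x = 0"
      using indicator_pe_density[OF that(1)] by simp
    with that(2) show False by linarith
  qed
  then have "AE x in lborel_pow N. 0 < ennreal (\<rho> x) \<longrightarrow> x \<in> set_pow I N"
    by (intro AE_I2 impI) (simp only: ennreal_less_zero_iff)
  then show ?thesis
    unfolding pe_measure_eq by (subst AE_density) measurable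
qed

private lemma
  assumes [measurable]: "g \<in> borel_measurable (lborel_pow N)"
  shows integrable_pe_measure: "integrable (pe_measure N I \<phi>) (\<lambda>x. g x / vandermonde N x) \<longleftrightarrow>
      integrable (lborel_pow N) (\<lambda>x. g x * \<Psi> x)" (is ?int)
    and integral_pe_measure: "(LINT x|pe_measure N I \<phi>. g x / vandermonde N x) =
      (LINT x|lborel_pow N. g x * \<Psi> x) / Z" (is ?eq)
proof -
  \<comment> \<open>The Vandermonde factor of the density cancels the denominator of the Schur
    polynomial. Where points coincide the quotient has the default value 0, but this is a null
    set.\<close>
  have AE: "AE x in lborel_pow N. \<rho> x *\<^sub>R (g x / vandermonde N x) = g x * \<Psi> x / Z"
    using AE_vandermonde_ne_0 by eventually_elim simp
  have "integrable (pe_measure N I \<phi>) (\<lambda>x. g x / vandermonde N x) \<longleftrightarrow>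
      integrable (lborel_pow N) (\<lambda>x. \<rho> x *\<^sub>R (g x / vandermonde N x))"
    unfolding pe_measure_eq using AE_\<rho>_nonneg by (intro integrable_density) auto
  also have "\<dots> \<longleftrightarrow> integrable (lborel_pow N) (\<lambda>x. g x * \<Psi> x / Z)"
    using AE by (intro integrable_cong_AE) auto
  also have "\<dots> \<longleftrightarrow> integrable (lborel_pow N) (\<lambda>x. g x * \<Psi> x)"
    unfolding divide_inverse using Z_ne_0 by (subst integrable_mult_right_iff) simp
  finally show ?int .
  have "(LINT x|pe_measure N I \<phi>. g x / vandermonde N x) =
      (LINT x|lborel_pow N. \<rho> x *\<^sub>R (g x / vandermonde N x))"
    unfolding pe_measure_eq using AE_\<rho>_nonneg by (intro integral_density) auto
  also have "\<dots> = (LINT x|lborel_pow N. g x * \<Psi> x / Z)"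
    using AE by (intro integral_cong_AE) auto
  finally show ?eq by simp
qed

text \<open>The exponents \<open>f j + (N - Suc j)\<close> strictly decrease in \<open>j\<close>, so
  \<open>integrable_moment\<close> yields the moment of order \<open>f 0 + (N - Suc 0)\<close>; the
  lower ones follow by domination.\<close>

private lemma integrable_moment_alternant:
  assumes f: "antimono f" and int: "integrable (lborel_pow N) (\<lambda>x. alternant f x * \<Psi> x)"
    and k: "k < f 0 + N" and l: "l < N"
  shows "integrable lborel (\<lambda>t. t ^ k * \<psi> l t)"
proof (rule integrable_lower_moment[OF integrable_\<psi>[OF l]])
  have less: "f j + (N - Suc j) < f i + (N - Suc i)" if "i < j" "j < N" for i j
    using antimonoD[OF f, of i j] that by linarith
  show "integrable lborel (\<lambda>t. t ^ (f 0 + (N - Suc 0)) * \<psi> l t)"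
  proof (rule integrable_moment[OF integrable_\<psi> _ _ int not_AE_\<Psi>_eq_0 l])
    show "inj_on (\<lambda>j. f j + (N - Suc j)) {..<N}"
      by (rule linorder_inj_onI) (use less in \<open>force+\<close>)
  qed (use less in auto)
  show "k \<le> f 0 + (N - Suc 0)"
    using k l by linarith
qed

private lemma integral_alternant:
  assumes "antimono f" and "\<And>k l. k < f 0 + N \<Longrightarrow> l < N \<Longrightarrow> integrable lborel (\<lambda>t. t ^ k * \<psi> l t)"
  shows "(LINT x|lborel_pow N. alternant f x * \<Psi> x) =
    fact N * fdet N (\<lambda>j l. moment (f j + (N - Suc j)) l)"
proof (rule integral_andreief)
  fix j l assume "j < N" "l < N"
  then show "integrable lborel (\<lambda>t. t ^ (f j + (N - Suc j)) * \<psi> l t)"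
    using antimonoD[OF assms(1), of 0 j] by (intro assms(2)) linarith+
qed

text \<open>The Vandermonde determinant is the alternant of the empty diagram, and existence of the
  normalisation constant already provides the moments of order below \<open>N\<close>.\<close>

private lemma Z_eq_moment_det: "Z = fact N * fdet N (\<lambda>j l. moment (N - Suc j) l)"
proof -
  have "integrable (lborel_pow N) (\<lambda>x. alternant (\<lambda>_. 0) x * \<Psi> x)"
    using integrable_weight by (simp add: vandermonde_eq)
  then have "integrable lborel (\<lambda>t. t ^ k * \<psi> l t)" if "k < N" "l < N" for k l
    using integrable_moment_alternant[of "\<lambda>_. 0"] that by (auto simp: antimono_def)
  then show ?thesis
    unfolding Z_eq vandermonde_eq
    by (subst integral_alternant) (auto simp: antimono_def)
qed

section \<open>Expectations of Schur polynomials as ratios of moment determinants\<close>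

lemma moment_det_ne_0: "fdet N (\<lambda>j l. LINT t|lborel. t ^ (N - Suc j) * (indicator I t * \<phi> l t)) \<noteq> 0"
  using Z_ne_0 by (simp add: Z_eq_moment_det)

lemma schur_eq: "schur N lam x =
    (if length lam \<le> N
     then fdet N (\<lambda>i j. x i ^ (row_length lam j + (N - Suc j))) / vandermonde N x else 0)"
  by (simp add: schur_def fdet_def)

lemma integrable_moment_schur:
  assumes "antimono (row_length lam)" "length lam \<le> N"
    and "integrable (pe_measure N I \<phi>) (schur N lam)"
    and "k < row_length lam 0 + N" "l < N"
  shows "integrable lborel (\<lambda>t. t ^ k * (indicator I t * \<phi> l t))"
proof -
  have "integrable (lborel_pow N) (\<lambda>x. alternant (row_length lam) x * \<Psi> x)"
    using assms(2,3) by (simp add: schur_eq[abs_def] integrable_pe_measure)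
  then show ?thesis
    using assms by (intro integrable_moment_alternant) auto
qed

text \<open>Andreief's identity applies to the numerator and to the normalisation constant, and the
  factors \<open>fact N\<close> cancel.\<close>

lemma integral_schur:
  assumes "antimono (row_length lam)" "length lam \<le> N"
    and "\<And>k l. k < row_length lam 0 + N \<Longrightarrow> l < N \<Longrightarrow>
      integrable lborel (\<lambda>t. t ^ k * (indicator I t * \<phi> l t))"
  shows "(LINT x|pe_measure N I \<phi>. schur N lam x) =
    fdet N (\<lambda>j l. moment (row_length lam j + (N - Suc j)) l) /
    fdet N (\<lambda>j l. moment (N - Suc j) l)"
  using assms by (simp add: schur_eq integral_pe_measure integral_alternant Z_eq_moment_det)

end

theorem theorem2p2:
  fixes N :: nat and I :: "real set" and \<phi> :: "nat \<Rightarrow> real \<Rightarrow> real"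
  assumes "polynomial_ensemble N I \<phi>"
  shows "giambelli_compatible N I (pe_measure N I \<phi>)"
  unfolding giambelli_compatible_def
proof (intro conjI allI impI)
  let ?M = "pe_measure N I \<phi>"
  show "prob_space ?M"
    by (rule prob_space_pe_measure[OF assms])
  show "sets ?M = sets (lborel_pow N)"
    by (simp add: pe_measure_def)
  show "AE x in ?M. x \<in> set_pow I N"
    by (rule AE_pe_measure_set_pow[OF assms])
  fix lam
  assume lam: "young_diagram lam" and int: "integrable ?M (schur N lam)"
  let ?f = "row_length lam" and ?d = "frob_rank lam"
  let ?E = "\<lambda>\<mu>. LINT x|?M. schur N \<mu> x"
  note f = antimono_row_length[OF lam]
  note d = less_frob_rank_iff[OF lam]
  have "?E lam = fdet ?d (\<lambda>i j. ?E (hook (frob_arm lam i) (frob_leg lam j)))"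
  proof (cases "length lam \<le> N")
    case True
    let ?m = "\<lambda>k l. LINT t|lborel. t ^ k * (indicator I t * \<phi> l t)"
    have f0: "\<forall>i\<ge>N. ?f i = 0"
      using True by (simp add: row_length_def)
    note moments = integrable_moment_schur[OF assms f True int]
    have hook: "?E (hook (frob_arm lam i) (frob_leg lam j)) =
        fdet N (\<lambda>r l. ?m (row_length (hook (?f i - Suc i) (leg ?f j)) r + (N - Suc r)) l) /
        fdet N (\<lambda>r l. ?m (N - Suc r) l)" if ij: "i < ?d" "j < ?d" for i j
      unfolding frob_arm_eq frob_leg_eq
    proof (rule integral_schur[OF assms antimono_row_length_hook])
      \<comment> \<open>Diagonal boxes lie in the first \<open>N\<close> rows, so all legs are
        shorter than \<open>N\<close> and each hook has at most \<open>N\<close> rows.\<close>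
      have "j < N"
        using f0 ij(2) d[of j] by (cases "j < N") auto
      then have "leg ?f j < N"
        by (rule leg_less[OF f f0])
      then show "length (hook (?f i - Suc i) (leg ?f j)) \<le> N"
        by (simp add: hook_def)
      \<comment> \<open>The first row of the hook has length \<open>?f i - i\<close>, so the moments
        obtained from \<open>lam\<close> reach far enough.\<close>
      have "row_length (hook (?f i - Suc i) (leg ?f j)) 0 \<le> ?f 0"
        using antimonoD[OF f, of 0 i] d[of i] ij(1) by (simp add: row_length_hook)
      then show "integrable lborel (\<lambda>t. t ^ k * (indicator I t * \<phi> l t))"
        if "k < row_length (hook (?f i - Suc i) (leg ?f j)) 0 + N" "l < N" for k l
        using that by (intro moments) linarith+
    qed
    have "?E lam = fdet N (\<lambda>r l. ?m (?f r + (N - Suc r)) l) / fdet N (\<lambda>r l. ?m (N - Suc r) l)"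
      by (rule integral_schur[OF assms f True]) (rule moments)
    also have "\<dots> = fdet ?d (\<lambda>i j. ?E (hook (frob_arm lam i) (frob_leg lam j)))"
      unfolding giambelli_ratio[OF moment_det_ne_0[OF assms] f f0 d]
      by (intro fdet_cong) (simp only: hook)
    finally show ?thesis .
  next
    \<comment> \<open>With more than \<open>N\<close> rows the first leg is at least
      \<open>N\<close> long. Then every hook in column 0 has more than \<open>N\<close> rows and
      expectation 0, so both sides vanish.\<close>
    case False
    then have "0 < ?f N"
      using lam by (simp add: row_length_def young_diagram_def)
    then have "0 < ?d" "N \<le> leg ?f 0"
      using d[of 0] antimonoD[OF f, of 0 N] leg_less_iff[OF f, of "length lam" N 0]
      by (auto simp: row_length_def)
    then have "schur N (hook (frob_arm lam i) (frob_leg lam 0)) = (\<lambda>_. 0)" for i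
      by (intro ext) (simp add: schur_def hook_def frob_leg_eq)
    moreover obtain n where "?d = Suc n"
      using \<open>0 < ?d\<close> by (cases ?d) auto
    ultimately have "fdet ?d (\<lambda>i j. ?E (hook (frob_arm lam i) (frob_leg lam j))) = 0"
      by (simp add: fdet_expand_col[of 0])
    moreover have "schur N lam = (\<lambda>_. 0)"
      using False by (intro ext) (simp add: schur_def)
    ultimately show ?thesis by simp
  qed
  then show "?E lam = Determinant.det (Matrix.mat ?d ?d
      (\<lambda>(i, j). ?E (hook (frob_arm lam i) (frob_leg lam j))))"
    by (simp only: fdet_def)
qed

end
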